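(* Multiplicative variance inflation with a constant inflation parameter cannot change the condition number or rank of a covariance matrix: if $\mathbf{R}\in\mathbb{R}^{d\times d}$ is a symmetric positive semi-definite matrix, $\alpha>0$ is a real number and $\mathbf{R}_{MVI}=\alpha^2\mathbf{R}$, then $\operatorname{rank}(\mathbf{R}_{MVI})=\operatorname{rank}(\mathbf{R})$ and $\kappa(\mathbf{R}_{MVI})=\kappa(\mathbf{R})$.
   Context: Multiplicative variance inflation with constant factor $\alpha>0$ replaces the standard deviation matrix $\boldsymbol{\Sigma}$ in $\mathbf{R}=\boldsymbol{\Sigma}\mathbf{C}\boldsymbol{\Sigma}$ (with $\mathbf{C}$ a correlation matrix) by $\alpha\boldsymbol{\Sigma}$, i.e. it replaces $\mathbf{R}$ by $\mathbf{R}_{MVI}=\alpha^2\mathbf{R}$. For a symmetric positive semi-definite matrix $\mathbf{S}\in\mathbb{R}^{d\times d}$ with eigenvalues $\lambda_1(\mathbf{S})\ge\dots\ge\lambda_d(\mathbf{S})\ge 0$, the condition number is $\kappa(\mathbf{S})=\lambda_1(\mathbf{S})/\lambda_d(\mathbf{S})$ if $\mathbf{S}$ is positive definite, and $\kappa(\mathbf{S})=\infty$ if $\mathbf{S}$ is singular. *)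

theory Defs
  imports "Jordan_Normal_Form.Char_Poly" "Jordan_Normal_Form.DL_Rank"
    "HOL-Library.Extended_Real"
begin

definition sym_pos_semidef :: "nat \<Rightarrow> real mat \<Rightarrow> bool" where
  "sym_pos_semidef d S \<longleftrightarrow>
     S \<in> carrier_mat d d \<and> transpose_mat S = S \<and>
     (\<forall>v \<in> carrier_vec d. 0 \<le> v \<bullet> (S *\<^sub>v v))"

definition sym_pos_def :: "nat \<Rightarrow> real mat \<Rightarrow> bool" where
  "sym_pos_def d S \<longleftrightarrow>
     S \<in> carrier_mat d d \<and> transpose_mat S = S \<and>
     (\<forall>v \<in> carrier_vec d. v \<noteq> 0\<^sub>v d \<longrightarrow> 0 < v \<bullet> (S *\<^sub>v v))"

(* The real roots of the characteristic polynomial, with multiplicity, in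
   non-increasing order.  For a real symmetric d x d matrix the characteristic
   polynomial splits over the reals, so this list has length d. *)
definition eigenvalues_desc :: "real mat \<Rightarrow> real list" where
  "eigenvalues_desc S = rev (sorted_list_of_multiset (proots (char_poly S)))"

(* Eigenvalues are numbered 1, ..., d, largest first; list positions start at 0. *)
definition eigval :: "nat \<Rightarrow> real mat \<Rightarrow> real" where
  "eigval i S = eigenvalues_desc S ! (i - 1)"

(* Intended for symmetric positive semi-definite S of dimension d \<ge> 1; for these,
   "not positive definite" is the same as "singular". *)
definition cond_number :: "nat \<Rightarrow> real mat \<Rightarrow> ereal" where
  "cond_number d S =
     (if sym_pos_def d S then ereal (eigval 1 S / eigval d S) else \<infinity>)"

end

theory Submission
  imports Defs
begin

text \<open>
  Write \<open>c = \<alpha>\<^sup>2\<close>, a nonzero scalar. The matrices \<open>R\<close> and \<open>c R\<close> have the same range, because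
  \<open>c R x = R (c x)\<close> and \<open>c\<close> is invertible; this gives the equality of the ranks.

  For the condition numbers, \<open>c > 0\<close> makes \<open>R\<close> positive definite exactly when \<open>c R\<close> is, so both
  condition numbers are infinite together. In the positive definite case, multiplication by \<open>c\<close> carries the roots of
  the characteristic polynomial of \<open>R\<close> to those of \<open>c R\<close> with their multiplicities, and, being
  increasing, it keeps their order. The largest and the smallest eigenvalue are thus both multiplied
  by \<open>c\<close>, and \<open>c\<close> cancels in their quotient.

  The numbering of the eigenvalues refers to a list of real roots, and its \<open>d\<close>-th entry is
  meaningful only if there are \<open>d\<close> real roots. This is where the symmetry of \<open>R\<close> enters: every
  complex eigenvalue of a real symmetric matrix is real, so its characteristic polynomial splits
  into \<open>d\<close> linear factors over the reals (lemma \<open>char_poly_real_symmetric_splits\<close>).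
\<close>

section \<open>Rank\<close>

lemma smult_mat_mult_vec:
  assumes "x \<in> carrier_vec (dim_col A)"
  shows "(c \<cdot>\<^sub>m A) *\<^sub>v x = c \<cdot>\<^sub>v (A *\<^sub>v x)"
  using assms by (intro eq_vecI) (auto simp: smult_scalar_prod_distrib[of _ "dim_col A"])

lemma (in vec_space) col_space_smult:
  assumes A: "A \<in> carrier_mat n nc" and c: "c \<noteq> 0"
  shows "col_space (c \<cdot>\<^sub>m A) = col_space A"
proof -
  have cA: "c \<cdot>\<^sub>m A \<in> carrier_mat n nc" using A by simp
  have "(\<exists>x\<in>carrier_vec nc. (c \<cdot>\<^sub>m A) *\<^sub>v x = y) \<longleftrightarrow> (\<exists>x\<in>carrier_vec nc. A *\<^sub>v x = y)" for y
  proof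
    assume "\<exists>x\<in>carrier_vec nc. (c \<cdot>\<^sub>m A) *\<^sub>v x = y"
    then obtain x where x: "x \<in> carrier_vec nc" "(c \<cdot>\<^sub>m A) *\<^sub>v x = y" by blast
    then have "A *\<^sub>v (c \<cdot>\<^sub>v x) = y"
      using A by (auto simp: mult_mat_vec smult_mat_mult_vec)
    then show "\<exists>x\<in>carrier_vec nc. A *\<^sub>v x = y" using x(1) smult_carrier_vec by blast
  next
    assume "\<exists>x\<in>carrier_vec nc. A *\<^sub>v x = y"
    then obtain x where x: "x \<in> carrier_vec nc" "A *\<^sub>v x = y" by blast
    then have "(c \<cdot>\<^sub>m A) *\<^sub>v ((1 / c) \<cdot>\<^sub>v x) = y"
      using A c by (auto simp: mult_mat_vec smult_mat_mult_vec smult_smult_assoc)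
    then show "\<exists>x\<in>carrier_vec nc. (c \<cdot>\<^sub>m A) *\<^sub>v x = y" using x(1) smult_carrier_vec by blast
  qed
  then show ?thesis unfolding col_space_eq[OF A] col_space_eq[OF cA] using A by auto
qed

lemma (in vec_space) rank_smult:
  assumes "A \<in> carrier_mat n nc" and "c \<noteq> 0"
  shows "rank (c \<cdot>\<^sub>m A) = rank A"
  using col_space_smult[OF assms] by (simp add: rank_def col_space_def)

section \<open>Characteristic polynomials of real symmetric matrices\<close>

text \<open>
  For an eigenvector \<open>v\<close> with \<open>A v = k v\<close>, the entries of \<open>A\<close> being real and symmetric allow
  \<open>A\<close> to be moved across the Hermitian product: \<open>k \<langle>v, v\<rangle> = \<langle>A v, v\<rangle> = \<langle>v, A v\<rangle> = cnj k \<langle>v, v\<rangle>\<close>.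
\<close>

lemma eigenvalue_real_symmetric_is_real:
  fixes A :: "real mat"
  assumes A: "A \<in> carrier_mat n n" and sym: "transpose_mat A = A"
    and ev: "eigenvalue (map_mat complex_of_real A) k"
  shows "k \<in> \<real>"
proof -
  let ?B = "map_mat complex_of_real A"
  have B: "?B \<in> carrier_mat n n" using A by simp
  have Bsym: "transpose_mat ?B = ?B" using sym by (metis map_mat_transpose)
  from ev B obtain v where v: "v \<in> carrier_vec n" "v \<noteq> 0\<^sub>v n" "?B *\<^sub>v v = k \<cdot>\<^sub>v v"
    unfolding eigenvalue_def eigenvector_def by auto
  have cv: "conjugate v \<in> carrier_vec n" using v(1) by simp
  have conj_mult: "conjugate (?B *\<^sub>v v) = ?B *\<^sub>v conjugate v"
  proof (rule eq_vecI)
    fix i assume "i < dim_vec (?B *\<^sub>v conjugate v)"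
    then have i: "i < n" using A by simp
    then show "conjugate (?B *\<^sub>v v) $ i = (?B *\<^sub>v conjugate v) $ i"
      using A v(1) by (auto simp: scalar_prod_def cnj_sum intro!: sum.cong)
  qed (use A in simp)
  have "k * (v \<bullet>c v) = (?B *\<^sub>v v) \<bullet>c v" using v by simp
  also have "\<dots> = v \<bullet> (?B *\<^sub>v conjugate v)"
    using transpose_vec_mult_scalar[OF B cv v(1)] v(1) B cv
    by (simp add: Bsym)
  also have "\<dots> = v \<bullet>c (k \<cdot>\<^sub>v v)" using conj_mult v(3) by simp
  also have "\<dots> = cnj k * (v \<bullet>c v)" using v(1) cv by (simp add: conjugate_smult_vec)
  finally have "k * (v \<bullet>c v) = cnj k * (v \<bullet>c v)" .
  moreover have "v \<bullet>c v \<noteq> 0" using v by simp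
  ultimately show ?thesis by (simp add: Reals_cnj_iff)
qed

text \<open>
  The factorization exists over the complex numbers; since all its roots are real, it is the image
  of a factorization over the reals.
\<close>

lemma char_poly_real_symmetric_splits:
  fixes A :: "real mat"
  assumes A: "A \<in> carrier_mat n n" and sym: "transpose_mat A = A"
  obtains bs where "char_poly A = (\<Prod>b\<leftarrow>bs. [:- b, 1:])" and "length bs = n"
proof -
  let ?B = "map_mat complex_of_real A"
  have B: "?B \<in> carrier_mat n n" using A by simp
  from char_poly_factorized[OF B] obtain as
    where as: "char_poly ?B = (\<Prod>a\<leftarrow>as. [:- a, 1:])" "length as = n" by blast
  have "a \<in> \<real>" if "a \<in> set as" for a
  proof -
    have "poly (char_poly ?B) a = 0" using that by (auto simp: as(1) poly_prod_list prod_list_zero_iff)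
    then have "eigenvalue ?B a" using eigenvalue_root_char_poly[OF B] by simp
    then show ?thesis by (rule eigenvalue_real_symmetric_is_real[OF A sym])
  qed
  then have as_Re: "as = map complex_of_real (map Re as)"
    by (simp add: list_eq_iff_nth_eq)
  interpret h: map_poly_comm_ring_hom complex_of_real ..
  have hom: "map_poly complex_of_real (\<Prod>b\<leftarrow>bs. [:- b, 1:])
      = (\<Prod>a\<leftarrow>map complex_of_real bs. [:- a, 1:])" for bs
    by (induction bs) (simp_all add: h.hom_mult del: mult_pCons_left)
  have "map_poly complex_of_real (char_poly A) = (\<Prod>a\<leftarrow>as. [:- a, 1:])"
    using as(1) of_real_hom.char_poly_hom[OF A, where 'a = complex] by simp
  also have "\<dots> = map_poly complex_of_real (\<Prod>b\<leftarrow>map Re as. [:- b, 1:])"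
    unfolding hom as_Re[symmetric] ..
  finally have "char_poly A = (\<Prod>b\<leftarrow>map Re as. [:- b, 1:])"
    by (simp add: poly_eq_iff coeff_map_poly)
  then show ?thesis using as(2) that[of "map Re as"] by simp
qed

section \<open>Scaling the eigenvalues\<close>

text \<open>
  This is \<open>det (c y - c A) = c\<^sup>n det (y - A)\<close>. Over an infinite field, where a polynomial is
  determined by its values, it yields the factorization of the characteristic polynomial of \<open>c A\<close>
  from that of \<open>A\<close>, and so the multiplicities of the roots as well.
\<close>

lemma poly_char_poly_smult:
  fixes A :: "'a :: field mat"
  assumes A: "A \<in> carrier_mat n n"
  shows "poly (char_poly (c \<cdot>\<^sub>m A)) (c * y) = c ^ n * poly (char_poly A) y"
proof -
  have cA: "c \<cdot>\<^sub>m A \<in> carrier_mat n n" using A by simp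
  have "- char_matrix (c \<cdot>\<^sub>m A) (c * y) = c \<cdot>\<^sub>m (- char_matrix A y)"
    using A by (intro eq_matI) (auto simp: char_matrix_def algebra_simps)
  moreover have "- char_matrix A y \<in> carrier_mat n n" using A by simp
  ultimately show ?thesis
    by (simp add: char_poly_matrix[OF A] char_poly_matrix[OF cA])
qed

lemma char_poly_smult_splits:
  fixes A :: "'a :: field_char_0 mat"
  assumes A: "A \<in> carrier_mat n n" and c: "c \<noteq> 0"
    and split: "char_poly A = (\<Prod>b\<leftarrow>bs. [:- b, 1:])" and len: "length bs = n"
  shows "char_poly (c \<cdot>\<^sub>m A) = (\<Prod>b\<leftarrow>map ((*) c) bs. [:- b, 1:])"
proof -
  have factor: "c ^ length bs * poly (\<Prod>b\<leftarrow>bs. [:- b, 1:]) y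
      = poly (\<Prod>b\<leftarrow>map ((*) c) bs. [:- b, 1:]) (c * y)" for y
    by (induction bs) (simp_all add: algebra_simps)
  have "poly (char_poly (c \<cdot>\<^sub>m A)) x = poly (\<Prod>b\<leftarrow>map ((*) c) bs. [:- b, 1:]) x" for x
    using poly_char_poly_smult[OF A, of c "x / c"] factor[of "x / c"] c
    by (simp add: split len)
  then show ?thesis by (simp add: poly_eq_poly_eq_iff[symmetric] fun_eq_iff)
qed

lemma eigenvalues_desc_split:
  assumes "char_poly A = (\<Prod>b\<leftarrow>bs. [:- b, 1:])"
  shows "eigenvalues_desc A = rev (sort bs)"
proof -
  have "proots (\<Prod>b\<leftarrow>bs. [:- b, 1:]) = mset bs"
  proof (induction bs)
    case (Cons b bs)
    have "(\<Prod>b\<leftarrow>bs. [:- b, 1:]) \<noteq> 0" by (auto simp: prod_list_zero_iff)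
    then show ?case using Cons.IH by (simp add: proots_mult del: mult_pCons_left)
  qed simp
  then show ?thesis using assms by (simp add: eigenvalues_desc_def)
qed

lemma sort_map_mult_pos:
  fixes c :: real
  assumes "c > 0"
  shows "sort (map ((*) c) xs) = map ((*) c) (sort xs)"
proof (rule properties_for_sort)
  show "sorted (map ((*) c) (sort xs))"
    using assms by (auto simp: sorted_map intro!: sorted_wrt_mono_rel[OF _ sorted_sort])
qed simp

lemma eigval_smult:
  assumes A: "A \<in> carrier_mat d d" and sym: "transpose_mat A = A" and c: "c > 0"
    and i: "1 \<le> i" "i \<le> d"
  shows "eigval i (c \<cdot>\<^sub>m A) = c * eigval i A"
proof -
  obtain bs where bs: "char_poly A = (\<Prod>b\<leftarrow>bs. [:- b, 1:])" "length bs = d"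
    using char_poly_real_symmetric_splits[OF A sym] .
  have "char_poly (c \<cdot>\<^sub>m A) = (\<Prod>b\<leftarrow>map ((*) c) bs. [:- b, 1:])"
    using char_poly_smult_splits[OF A _ bs] c by simp
  then have "eigenvalues_desc (c \<cdot>\<^sub>m A) = map ((*) c) (eigenvalues_desc A)"
    by (simp add: eigenvalues_desc_split[OF bs(1)] eigenvalues_desc_split
        sort_map_mult_pos[OF c] rev_map del: map_map)
  moreover have "length (eigenvalues_desc A) = d"
    by (simp add: eigenvalues_desc_split[OF bs(1)] bs(2))
  ultimately show ?thesis using i by (simp add: eigval_def)
qed

section \<open>Condition number\<close>

lemma sym_pos_def_smult:
  assumes A: "A \<in> carrier_mat d d" and c: "c > 0"
  shows "sym_pos_def d (c \<cdot>\<^sub>m A) \<longleftrightarrow> sym_pos_def d A"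
proof -
  have "transpose_mat (c \<cdot>\<^sub>m A) = c \<cdot>\<^sub>m transpose_mat A" by (rule eq_matI) auto
  moreover have "c \<cdot>\<^sub>m transpose_mat A = c \<cdot>\<^sub>m A \<longleftrightarrow> transpose_mat A = A"
    using c by (auto simp: mat_eq_iff)
  moreover have "v \<bullet> ((c \<cdot>\<^sub>m A) *\<^sub>v v) = c * (v \<bullet> (A *\<^sub>v v))" if "v \<in> carrier_vec d" for v
    using A that by (simp add: smult_mat_mult_vec)
  ultimately show ?thesis
    using A c by (simp add: sym_pos_def_def zero_less_mult_iff)
qed

lemma cond_number_smult:
  assumes "d \<ge> 1" and A: "A \<in> carrier_mat d d" and c: "c > 0"
  shows "cond_number d (c \<cdot>\<^sub>m A) = cond_number d A"
proof (cases "sym_pos_def d A")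
  case True
  then have "transpose_mat A = A" by (simp add: sym_pos_def_def)
  then have "eigval i (c \<cdot>\<^sub>m A) = c * eigval i A" if "1 \<le> i" "i \<le> d" for i
    using eigval_smult[OF A _ c] that by simp
  then show ?thesis
    using \<open>d \<ge> 1\<close> c by (simp add: cond_number_def sym_pos_def_smult[OF A c])
next
  case False
  then show ?thesis by (simp add: cond_number_def sym_pos_def_smult[OF A c])
qed

theorem theorem5:
  fixes d :: nat and R R_MVI :: "real mat" and \<alpha> :: real
  assumes "d \<ge> 1"
    and "sym_pos_semidef d R"
    and "\<alpha> > 0"
    and "R_MVI = \<alpha>\<^sup>2 \<cdot>\<^sub>m R"
  shows "vec_space.rank d R_MVI = vec_space.rank d R
    \<and> cond_number d R_MVI = cond_number d R"
proof -
  have R: "R \<in> carrier_mat d d" using assms(2) by (simp add: sym_pos_semidef_def)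
  have c: "\<alpha>\<^sup>2 > 0" using assms(3) by simp
  show ?thesis
    using vec_space.rank_smult[OF R, of "\<alpha>\<^sup>2"] cond_number_smult[OF assms(1) R c] c
    by (simp add: assms(4))
qed

end
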